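(* Let $r\ge4$. There is a constant $K(r)$, depending only on $r$, such that for every $N$, every $i\in\mathbb Z$ and every $U\subset\mathbb R^N$ with $\gamma_{1/2}(U)\le r^{-i}$, $$\theta_i(U+r^{-i}B_1)\le K(r)\,r^{-i}.$$
   Context: $\lambda$ is the counting measure on $\{1,\dots,N\}$, so $L^2(\lambda)=\mathbb R^N$ with the Euclidean norm, and $B_1=\{t\in\mathbb R^N:\sum_{m\le N}|t_m|\le1\}$. For $j\in\mathbb Z$ and $f,g\in\mathbb R^N$ let $$\varphi_j(f,g)=\sum_{m\le N}\min\big(1,r^{2j}(f_m-g_m)^2\big),\qquad D_j(S)=\sup\{\varphi_j(s,t):s,t\in S\}.$$ For $T\subset\mathbb R^N$, $\theta_i(T)$ is the infimum of $$\sup_{x\in T}\sum_{j\ge i}r^{-j}\Big(D_j(C_j(x))+\log\frac1{\mu(C_j(x))}\Big)$$ over all increasing sequences $(\mathcal C_j)_{j\ge i}$ of finite partitions of $T$ (it is not required that $\mathcal C_i=\{T\}$) and all probability measures $\mu$ on $T$, where $C_j(x)$ is the element of $\mathcal C_j$ containing $x$. $\gamma_{1/2}(U)=\inf_\mu\sup_{x\in U}\int_0^\infty\sqrt{\log\frac1{\mu(B(x,\varepsilon))}}\,d\varepsilon$, with $B(x,\varepsilon)$ the closed Euclidean ball and the infimum over probability measures on $U$ (equivalently, supported by a countable set). *)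

theory Defs
  imports "HOL-Probability.Probability"
begin

(* The constant in the theorem is uniform in the dimension, so the dimension is a
   natural number N rather than a type: R^N is the set of functions {1..N} -> R,
   which is also the underlying set of the product Borel space borel_RN N. *)

definition RN :: "nat \<Rightarrow> (nat \<Rightarrow> real) set" where
  "RN N = {1..N} \<rightarrow>\<^sub>E UNIV"

definition borel_RN :: "nat \<Rightarrow> (nat \<Rightarrow> real) measure" where
  "borel_RN N = Pi\<^sub>M {1..N} (\<lambda>_. borel)"

definition euclid_dist :: "nat \<Rightarrow> (nat \<Rightarrow> real) \<Rightarrow> (nat \<Rightarrow> real) \<Rightarrow> real" where
  "euclid_dist N f g = L2_set (\<lambda>m. f m - g m) {1..N}"

definition B1 :: "nat \<Rightarrow> (nat \<Rightarrow> real) set" where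
  "B1 N = {t \<in> RN N. (\<Sum>m\<in>{1..N}. \<bar>t m\<bar>) \<le> 1}"

definition plus_scaled ::
  "nat \<Rightarrow> (nat \<Rightarrow> real) set \<Rightarrow> real \<Rightarrow> (nat \<Rightarrow> real) set \<Rightarrow> (nat \<Rightarrow> real) set" where
  "plus_scaled N U c B = {\<lambda>m\<in>{1..N}. u m + c * b m | u b. u \<in> U \<and> b \<in> B}"

definition log_inv :: "real \<Rightarrow> ennreal" where
  "log_inv p = (if p = 0 then \<infinity> else ennreal (ln (1 / p)))"

definition esqrt :: "ennreal \<Rightarrow> ennreal" where
  "esqrt x = (if x = \<infinity> then \<infinity> else ennreal (sqrt (enn2real x)))"

definition gamma_half :: "nat \<Rightarrow> (nat \<Rightarrow> real) set \<Rightarrow> ennreal" where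
  "gamma_half N U =
    (INF \<mu> \<in> {\<mu>. prob_space \<mu> \<and> sets \<mu> = sets (restrict_space (borel_RN N) U)}.
      SUP x\<in>U. \<integral>\<^sup>+\<epsilon>\<in>{0..}. esqrt (log_inv (measure \<mu> {y\<in>U. euclid_dist N x y \<le> \<epsilon>})) \<partial>lborel)"

definition phi :: "real \<Rightarrow> nat \<Rightarrow> int \<Rightarrow> (nat \<Rightarrow> real) \<Rightarrow> (nat \<Rightarrow> real) \<Rightarrow> real" where
  "phi r N j f g = (\<Sum>m\<in>{1..N}. min 1 (r powi (2 * j) * (f m - g m)\<^sup>2))"

definition Dsup :: "real \<Rightarrow> nat \<Rightarrow> int \<Rightarrow> (nat \<Rightarrow> real) set \<Rightarrow> ennreal" where
  "Dsup r N j S = (SUP (s, t) \<in> S \<times> S. ennreal (phi r N j s t))"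

definition cell :: "'a set set \<Rightarrow> 'a \<Rightarrow> 'a set" where
  "cell P x = (THE c. c \<in> P \<and> x \<in> c)"

(* Only the values C j with j >= i matter; "increasing" means successively finer. *)

definition increasing_partitions :: "int \<Rightarrow> 'a set \<Rightarrow> (int \<Rightarrow> 'a set set) \<Rightarrow> bool" where
  "increasing_partitions i T C \<longleftrightarrow>
    (\<forall>j\<ge>i. finite (C j) \<and> partition_on T (C j) \<and> refines T (C (j + 1)) (C j))"

(* The cells are arbitrary subsets of T, so the probability measure lives on any
   sigma-algebra of T containing all of them. Restricting to measures supported by a
   countable set would give the same infimum: replace a measure by a countable
   combination of discrete measures agreeing with it on C j, with weight near 1 on a
   single high level j. *)

definition theta :: "real \<Rightarrow> nat \<Rightarrow> int \<Rightarrow> (nat \<Rightarrow> real) set \<Rightarrow> ennreal" where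
  "theta r N i T =
    (INF (C, \<mu>) \<in> {(C, \<mu>). increasing_partitions i T C \<and> prob_space \<mu> \<and> space \<mu> = T \<and>
                        (\<forall>j\<ge>i. C j \<subseteq> sets \<mu>)}.
      SUP x\<in>T. \<Sum>\<^sub>\<infinity>j\<in>{i..}. ennreal (r powi (- j)) *
        (Dsup r N j (cell (C j) x) + log_inv (measure \<mu> (cell (C j) x))))"

end

(* Labels attached to the points of T, one family for each level n, give increasing partitions by
   taking joins: passing to the join adds up the logarithms of the weights, and the factor r^(-n)
   absorbs this. So it is enough to label each level separately, and U and B_1 can be treated
   independently, since phi is quasi-subadditive.

   For b in B_1 the label is the integer part of phi_n(b, 0). As
   phi_n(b, b') <= 2 (phi_n(b, 0) + phi_n(b', 0)), this controls D_n, while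
   sum_n r^(-n) phi_n(b, 0) <= 4 sum_m |b_m|; the number of labels is at most 1 + r^n, whatever
   the dimension.

   For x in U, level n works at the smallest scale e_k ~ r^(-i-k), k <= n, at which
   log (1 / mu(B(x, e_k))) <= r^(2(n-k)). Centers with disjoint balls of radius e_k then have total
   weight at most 1, both contributions of level n are of order r^(-i) r^(n-2k), and the failure of
   the inequality at scale k+1 bounds their sum over n by the integral that defines gamma_half. *)

theory Submission
  imports Defs
begin

lemma sum_power_le:
  fixes x :: real
  assumes "0 \<le> x" "x \<le> 1/4"
  shows "(\<Sum>n<M. x ^ n) \<le> 4/3"
proof -
  have "(\<Sum>n<M. x ^ n) + 4/3 * x ^ M \<le> 4/3"
  proof (induction M)
    case (Suc M)
    have "4/3 * x * x ^ M \<le> 1/3 * x ^ M"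
      using assms by (intro mult_right_mono) auto
    then show ?case using Suc by (simp add: algebra_simps)
  qed simp
  moreover have "0 \<le> x ^ M" using assms by simp
  ultimately show ?thesis by linarith
qed

lemma sum_of_nat_mult_power_le:
  fixes x :: real
  assumes "0 \<le> x" "x \<le> 1/4"
  shows "(\<Sum>n<M. real n * x ^ n) \<le> 1"
proof -
  have two: "2 * n \<le> 2 ^ n" for n :: nat
  proof (induction n)
    case (Suc n)
    show ?case using Suc by (cases n) auto
  qed simp
  have "real n * x ^ n \<le> 1/2 * (1/2) ^ n" for n
  proof -
    have "real n * x ^ n \<le> real n * (1/4) ^ n"
      using assms by (intro mult_left_mono power_mono) auto
    also have "2 * real n \<le> 2 ^ n"
      using two[of n] by (metis of_nat_le_iff of_nat_mult of_nat_numeral of_nat_power)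
    then have "real n * (1/4) ^ n \<le> (1/2 * 2 ^ n) * (1/4) ^ n"
      by (intro mult_right_mono) auto
    also have "\<dots> = 1/2 * (1/2) ^ n"
      by (simp add: power_mult_distrib[symmetric] mult.assoc)
    finally show ?thesis .
  qed
  then have "(\<Sum>n<M. real n * x ^ n) \<le> (\<Sum>n<M. 1/2 * (1/2) ^ n)"
    by (rule sum_mono)
  also have "\<dots> = 1 - (1/2::real) ^ M"
    by (induction M) auto
  finally show ?thesis by (simp add: order_trans)
qed

lemma sum_power_partial_sums_le:
  fixes x :: real and a :: "nat \<Rightarrow> real"
  assumes "0 \<le> x" "x \<le> 1/4" and a: "\<And>l. 0 \<le> a l"
  shows "(\<Sum>n<M. x ^ n * (\<Sum>l\<le>n. a l)) \<le> 4/3 * (\<Sum>l<M. x ^ l * a l)"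
proof -
  have "(\<Sum>n<M. x ^ n * (\<Sum>l\<le>n. a l)) + 4/3 * x ^ M * (\<Sum>l<M. a l) \<le> 4/3 * (\<Sum>l<M. x ^ l * a l)"
  proof (induction M)
    case (Suc M)
    define S where "S = (\<Sum>l<M. a l)"
    have S: "(\<Sum>l\<le>M. a l) = S + a M" "(\<Sum>l<Suc M. a l) = S + a M"
      by (simp_all add: S_def lessThan_Suc_atMost[symmetric])
    have "0 \<le> x ^ M * (S + a M)"
      using assms by (auto simp: S_def intro!: mult_nonneg_nonneg add_nonneg_nonneg sum_nonneg)
    then have "4/3 * x * (x ^ M * (S + a M)) \<le> 1/3 * (x ^ M * (S + a M))"
      using assms by (intro mult_right_mono) auto
    moreover have "4/3 * x ^ Suc M * (S + a M) = 4/3 * x * (x ^ M * (S + a M))"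
      "4/3 * (\<Sum>l<Suc M. x ^ l * a l) = 4/3 * (\<Sum>l<M. x ^ l * a l) + 4/3 * (x ^ M * (S + a M)) - 4/3 * x ^ M * S"
      by (simp_all add: algebra_simps)
    ultimately show ?case using Suc unfolding S sum.lessThan_Suc[of "\<lambda>n. x ^ n * (\<Sum>l\<le>n. a l)"]
      by (fold S_def) linarith
  qed simp
  moreover have "0 \<le> 4/3 * x ^ M * (\<Sum>l<M. a l)"
    using assms by (auto intro!: mult_nonneg_nonneg sum_nonneg)
  ultimately show ?thesis by linarith
qed

lemma sum_power_below_le:
  fixes r G :: real
  assumes "r \<ge> 4" "0 \<le> G"
  shows "(\<Sum>n<M. if r ^ n < G then r ^ n else 0) \<le> 4/3 * G"
proof (induction M)
  case (Suc M)
  have geom: "(\<Sum>n<M. r ^ n) \<le> r ^ M / 3" for M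
  proof (induction M)
    case (Suc M)
    have "4 * r ^ M \<le> r * r ^ M" using assms by (intro mult_right_mono) auto
    then show ?case using Suc by simp
  qed (use assms in auto)
  show ?case
  proof (cases "r ^ M < G")
    case True
    have "(\<Sum>n<M. if r ^ n < G then r ^ n else 0) \<le> (\<Sum>n<M. r ^ n)"
      using assms by (intro sum_mono) auto
    then show ?thesis using geom[of M] True by simp
  qed (use Suc in simp)
qed (use assms in simp)

lemma sum_power_below_le':
  fixes x a :: real
  assumes "0 < x" "x \<le> 1/4" "0 \<le> a"
  shows "(\<Sum>n<M. if x ^ n < a then x ^ n else 0) \<le> 4/3 * a"
  using \<open>0 \<le> a\<close>
proof (induction M arbitrary: a)
  case (Suc M)
  show ?case
  proof (cases "1 < a")
    case True
    have "(\<Sum>n<Suc M. if x ^ n < a then x ^ n else 0) \<le> (\<Sum>n<Suc M. x ^ n)"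
      using assms by (intro sum_mono) auto
    also have "\<dots> \<le> 4/3" using assms by (intro sum_power_le) auto
    finally show ?thesis using True by simp
  next
    case False
    have "(\<Sum>n<Suc M. if x ^ n < a then x ^ n else 0) =
        (\<Sum>n<M. if x ^ Suc n < a then x ^ Suc n else 0)"
      using False by (subst sum.lessThan_Suc_shift) auto
    also have "\<dots> = x * (\<Sum>n<M. if x ^ n < a / x then x ^ n else 0)"
      unfolding sum_distrib_left using \<open>0 < x\<close> by (intro sum.cong) (auto simp: field_simps)
    also have "\<dots> \<le> x * (4/3 * (a / x))"
      using \<open>0 < x\<close> Suc.prems by (intro mult_left_mono Suc.IH) auto
    finally show ?thesis using \<open>0 < x\<close> by simp
  qed
qed simp

lemma theta_le_of_labels:
  fixes h :: "nat \<Rightarrow> (nat \<Rightarrow> real) \<Rightarrow> 'b" and q :: "nat \<Rightarrow> 'b pmf" and d :: "nat \<Rightarrow> (nat \<Rightarrow> real) \<Rightarrow> real"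
  assumes r: "r \<ge> 4" and T: "T \<noteq> {}"
    and fin: "\<And>n. finite (h n ` T)"
    and pos: "\<And>n x. x \<in> T \<Longrightarrow> 0 < pmf (q n) (h n x)"
    and d: "\<And>n x s t. x \<in> T \<Longrightarrow> s \<in> T \<Longrightarrow> t \<in> T \<Longrightarrow> h n s = h n x \<Longrightarrow> h n t = h n x \<Longrightarrow>
              phi r N (i + int n) s t \<le> d n x"
    and K: "\<And>x M. x \<in> T \<Longrightarrow> (\<Sum>n<M. (1/r) ^ n * (d n x + ln (1 / pmf (q n) (h n x)))) \<le> K"
  shows "theta r N i T \<le> ennreal ((2 * K + 3) * r powi (- i))"
proof -
  define Z where "Z n x = {y \<in> T. \<forall>l\<le>n. h l y = h l x}" for n x
  define C where "C j = Z (nat (j - i)) ` T" for j :: int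
  obtain t0 where t0: "t0 \<in> T" using T by blast
  define rep where "rep n f = (if \<exists>y\<in>T. \<forall>l\<le>n. h l y = f l
      then SOME y. y \<in> T \<and> (\<forall>l\<le>n. h l y = f l) else t0)" for n :: nat and f
  \<comment> \<open>Choose a level geometrically, then labels up to that level independently. This single measure
    is good for all levels at once.\<close>
  define p where "p = bind_pmf (geometric_pmf (1/2)) (\<lambda>n. map_pmf (rep n) (Pi_pmf {..n} undefined q))"
  define \<mu> where "\<mu> = restrict_space (measure_pmf p) T"
  have rep_T: "rep n f \<in> T" for n f
    using t0 someI_ex[of "\<lambda>y. y \<in> T \<and> (\<forall>l\<le>n. h l y = f l)"] unfolding rep_def by auto
  have rep_h: "h l (rep n f) = f l" if "y \<in> T" "\<forall>l\<le>n. h l y = f l" "l \<le> n" for n f l y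
    using that someI_ex[of "\<lambda>y. y \<in> T \<and> (\<forall>l\<le>n. h l y = f l)"] unfolding rep_def by auto
  have "set_pmf p \<subseteq> T" using rep_T by (auto simp: p_def)
  then have "emeasure (measure_pmf p) T = 1"
    by (intro measure_pmf.emeasure_eq_1_AE) (auto simp: AE_measure_pmf_iff)
  then have prob: "prob_space \<mu>" unfolding \<mu>_def by (intro prob_space_restrict_space) auto
  have space: "space \<mu> = T" by (simp add: \<mu>_def space_restrict_space)
  have sets: "A \<in> sets \<mu>" if "A \<subseteq> T" for A
    using that by (simp add: \<mu>_def sets_restrict_space image_iff) blast
  have Zself: "x \<in> Z n x" if "x \<in> T" for n x using that by (simp add: Z_def)
  have Zeq: "Z n x = Z n y" if "z \<in> Z n x" "z \<in> Z n y" for n x y z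
    using that by (auto simp: Z_def)
  have cell: "cell (C (i + int n)) x = Z n x" if "x \<in> T" for n x
    unfolding cell_def
  proof (rule the_equality)
    show "Z n x \<in> C (i + int n) \<and> x \<in> Z n x" using that Zself by (auto simp: C_def)
    show "c = Z n x" if "c \<in> C (i + int n) \<and> x \<in> c" for c
    proof -
      from that obtain y where "c = Z n y" "x \<in> Z n y" by (auto simp: C_def)
      then show ?thesis using Zeq[of x n y x] Zself[OF \<open>x \<in> T\<close>] by simp
    qed
  qed
  have part: "partition_on T (C j)" for j
  proof (rule partition_onI)
    show "\<Union> (C j) = T" using Zself by (auto simp: C_def Z_def)
    show "{} \<notin> C j" unfolding C_def by (metis Zself empty_iff imageE)
    show "disjnt P Q" if "P \<in> C j" "Q \<in> C j" "P \<noteq> Q" for P Q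
    proof -
      from that obtain x y where "P = Z (nat (j - i)) x" "Q = Z (nat (j - i)) y" by (auto simp: C_def)
      then show ?thesis using Zeq[of _ "nat (j - i)" x y] \<open>P \<noteq> Q\<close> by (auto simp: disjnt_iff)
    qed
  qed
  have "finite (C j)" for j
  proof -
    let ?n = "nat (j - i)"
    have "Z ?n x = {y \<in> T. \<forall>l\<le>?n. h l y = (\<lambda>l\<in>{..?n}. h l x) l}" for x
      by (auto simp: Z_def)
    then have "C j \<subseteq> (\<lambda>f. {y \<in> T. \<forall>l\<le>?n. h l y = f l}) ` (PiE {..?n} (\<lambda>l. h l ` T))"
      unfolding C_def
    proof (intro image_subsetI)
      fix x assume "x \<in> T" and Z: "\<And>x. Z ?n x = {y \<in> T. \<forall>l\<le>?n. h l y = (\<lambda>l\<in>{..?n}. h l x) l}"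
      then have "(\<lambda>l\<in>{..?n}. h l x) \<in> PiE {..?n} (\<lambda>l. h l ` T)" by auto
      then show "Z ?n x \<in> (\<lambda>f. {y \<in> T. \<forall>l\<le>?n. h l y = f l}) ` (PiE {..?n} (\<lambda>l. h l ` T))"
        using Z[of x] by blast
    qed
    moreover have "finite (PiE {..?n} (\<lambda>l. h l ` T))" by (intro finite_PiE fin) auto
    ultimately show ?thesis by (meson finite_subset finite_imageI)
  qed
  moreover have "refines T (C (j + 1)) (C j)" if "j \<ge> i" for j
    unfolding refines_def
  proof (intro conjI part ballI)
    fix X assume "X \<in> C (j + 1)"
    then obtain x where x: "x \<in> T" "X = Z (nat (j + 1 - i)) x" by (auto simp: C_def)
    have "X \<subseteq> Z (nat (j - i)) x" using that x by (auto simp: Z_def)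
    then show "\<exists>Y\<in>C j. X \<subseteq> Y" using x by (auto simp: C_def)
  qed
  ultimately have inc: "increasing_partitions i T C"
    unfolding increasing_partitions_def using part by blast
  define a where "a l x = ln (1 / pmf (q l) (h l x))" for l x
  have a0: "0 \<le> a l x" if "x \<in> T" for l x
    using pos[OF that, of l] pmf_le_1[of "q l" "h l x"] by (simp add: a_def)
  have meas: "measure \<mu> (Z n x) \<ge> (1/2) ^ Suc n * (\<Prod>l\<le>n. pmf (q l) (h l x))" if x: "x \<in> T" for n x
  proof -
    define f where "f l = (if l \<le> n then h l x else undefined)" for l
    have "rep n f \<in> Z n x"
      unfolding Z_def using rep_T rep_h[of x n f, OF x] by (auto simp: f_def)
    then have "ennreal (pmf (Pi_pmf {..n} undefined q) f) \<le> emeasure (map_pmf (rep n) (Pi_pmf {..n} undefined q)) (Z n x)"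
      unfolding emeasure_pmf_single[symmetric] emeasure_map_pmf by (intro emeasure_mono) auto
    moreover have "pmf (Pi_pmf {..n} undefined q) f = (\<Prod>l\<le>n. pmf (q l) (h l x))"
      by (subst pmf_Pi') (auto simp: f_def)
    ultimately have *: "ennreal (\<Prod>l\<le>n. pmf (q l) (h l x)) \<le> emeasure (map_pmf (rep n) (Pi_pmf {..n} undefined q)) (Z n x)"
      by simp
    have "ennreal ((1/2) ^ Suc n * (\<Prod>l\<le>n. pmf (q l) (h l x))) =
        ennreal (\<Prod>l\<le>n. pmf (q l) (h l x)) * emeasure (geometric_pmf (1/2)) {n}"
      by (simp add: emeasure_pmf_single ennreal_mult[symmetric] prod_nonneg mult.commute)
    also have "\<dots> = (\<integral>\<^sup>+k. ennreal (\<Prod>l\<le>n. pmf (q l) (h l x)) * indicator {n} k \<partial>geometric_pmf (1/2))"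
      by (subst nn_integral_cmult_indicator) auto
    also have "\<dots> \<le> emeasure p (Z n x)"
      unfolding p_def emeasure_bind_pmf using *
      by (intro nn_integral_mono) (auto split: split_indicator)
    finally have "(1/2) ^ Suc n * (\<Prod>l\<le>n. pmf (q l) (h l x)) \<le> measure p (Z n x)"
      by (simp add: measure_pmf.emeasure_eq_measure)
    also have "measure p (Z n x) = measure \<mu> (Z n x)"
      unfolding \<mu>_def by (subst measure_restrict_space) (auto simp: Z_def)
    finally show ?thesis .
  qed
  have log: "log_inv (measure \<mu> (Z n x)) \<le> ennreal ((\<Sum>l\<le>n. a l x) + (1 + real n))" if x: "x \<in> T" for n x
  proof -
    let ?w = "(1/2) ^ Suc n * (\<Prod>l\<le>n. pmf (q l) (h l x))"
    have w: "?w > 0" using pos[OF x] by (intro mult_pos_pos prod_pos) auto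
    have "ln (1 / measure \<mu> (Z n x)) \<le> ln (1 / ?w)"
      using meas[OF x, of n] w by (subst ln_le_cancel_iff) (auto intro!: divide_left_mono simp del: power_Suc)
    also have "1 / ?w = 2 ^ Suc n * (\<Prod>l\<le>n. 1 / pmf (q l) (h l x))"
      by (simp add: prod_dividef power_one_over field_simps)
    also have "ln \<dots> = ln (2 ^ Suc n) + ln (\<Prod>l\<le>n. 1 / pmf (q l) (h l x))"
      using pos[OF x] by (intro ln_mult_pos prod_pos) (auto simp del: power_Suc)
    also have "ln (\<Prod>l\<le>n. 1 / pmf (q l) (h l x)) = (\<Sum>l\<le>n. a l x)"
      unfolding a_def using pos[OF x] by (subst ln_prod) (auto simp: less_imp_neq[THEN not_sym])
    also have "ln ((2::real) ^ Suc n) \<le> 1 + real n"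
      using ln_2_less_1 by (subst ln_realpow) (auto intro!: mult_left_le simp del: power_Suc)
    finally have "ln (1 / measure \<mu> (Z n x)) \<le> (\<Sum>l\<le>n. a l x) + (1 + real n)" by simp
    moreover have "measure \<mu> (Z n x) \<noteq> 0" using meas[OF x, of n] w by linarith
    ultimately show ?thesis by (simp add: log_inv_def ennreal_leI)
  qed
  have d0: "0 \<le> d n x" if "x \<in> T" for n x
    using d[OF that that that, of n] by (auto simp: phi_def)
  have bound: "Dsup r N (i + int n) (Z n x) \<le> ennreal (d n x)" if "x \<in> T" for n x
    unfolding Dsup_def using d[OF that]
    by (intro SUP_least) (auto simp: Z_def intro!: ennreal_leI)
  have x: "0 \<le> 1/r" "1/r \<le> 1/4" using r by (auto simp: field_simps)
  have main: "(\<Sum>\<^sub>\<infinity>j\<in>{i..}. ennreal (r powi (- j)) *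
        (Dsup r N j (cell (C j) x) + log_inv (measure \<mu> (cell (C j) x)))) \<le> ennreal ((2 * K + 3) * r powi (- i))"
    (is "infsum ?f _ \<le> _") if xT: "x \<in> T" for x
  proof (rule infsum_le_finite_sums)
    fix F assume F: "finite F" "F \<subseteq> {i..}"
    obtain M where M: "F \<subseteq> (\<lambda>n. i + int n) ` {..<M}"
    proof -
      have "F = (\<lambda>n. i + int n) ` (\<lambda>j. nat (j - i)) ` F"
        using F(2) by (force simp: image_image)
      moreover obtain M where "(\<lambda>j. nat (j - i)) ` F \<subseteq> {..<M}"
        using F(1) finite_nat_bounded[of "(\<lambda>j. nat (j - i)) ` F"] by auto
      ultimately show ?thesis using that by (metis image_mono)
    qed
    define b where "b n = d n x + ((\<Sum>l\<le>n. a l x) + (1 + real n))" for n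
    have b0: "0 \<le> b n" for n
      unfolding b_def using d0[OF xT] a0[OF xT] by (auto intro!: add_nonneg_nonneg sum_nonneg)
    have "sum ?f F \<le> sum ?f ((\<lambda>n. i + int n) ` {..<M})"
      using M by (intro sum_mono2) auto
    also have "\<dots> = (\<Sum>n<M. ?f (i + int n))"
      by (subst sum.reindex) (auto simp: inj_on_def)
    also have "\<dots> \<le> (\<Sum>n<M. ennreal (r powi (- i) * ((1/r) ^ n * b n)))"
    proof (rule sum_mono)
      fix n
      have "?f (i + int n) \<le> ennreal (r powi (- (i + int n))) * (ennreal (d n x) + ennreal ((\<Sum>l\<le>n. a l x) + (1 + real n)))"
        unfolding cell[OF xT] by (intro mult_left_mono add_mono bound log xT) auto
      also have "\<dots> = ennreal (r powi (- (i + int n)) * b n)"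
        unfolding b_def using d0[OF xT] a0[OF xT] r
        by (subst ennreal_plus[symmetric]) (auto intro!: add_nonneg_nonneg sum_nonneg simp: ennreal_mult')
      also have "r powi (- (i + int n)) * b n = r powi (- i) * ((1/r) ^ n * b n)"
        using r by (simp add: power_int_add power_int_diff power_int_minus power_one_over field_simps)
      finally show "?f (i + int n) \<le> ennreal (r powi (- i) * ((1/r) ^ n * b n))" .
    qed
    also have "\<dots> = ennreal (r powi (- i) * (\<Sum>n<M. (1/r) ^ n * b n))"
      using b0 r by (subst sum_ennreal) (auto simp: sum_distrib_left)
    also have "\<dots> \<le> ennreal ((2 * K + 3) * r powi (- i))"
    proof (rule ennreal_leI)
      have "(\<Sum>n<M. (1/r) ^ n * b n) = (\<Sum>n<M. (1/r) ^ n * d n x) + (\<Sum>n<M. (1/r) ^ n * (\<Sum>l\<le>n. a l x))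
          + ((\<Sum>n<M. (1/r) ^ n) + (\<Sum>n<M. real n * (1/r) ^ n))"
        by (simp add: b_def algebra_simps sum.distrib)
      also have "\<dots> \<le> (\<Sum>n<M. (1/r) ^ n * d n x) + 4/3 * (\<Sum>n<M. (1/r) ^ n * a n x) + (4/3 + 1)"
        using x a0[OF xT] by (intro add_mono sum_power_partial_sums_le sum_power_le sum_of_nat_mult_power_le order_refl)
      also have "\<dots> \<le> 4/3 * (\<Sum>n<M. (1/r) ^ n * (d n x + a n x)) + 7/3"
      proof -
        have "0 \<le> (\<Sum>n<M. (1/r) ^ n * d n x)" using d0[OF xT] r by (intro sum_nonneg) auto
        then show ?thesis by (simp add: algebra_simps sum.distrib)
      qed
      also have "\<dots> \<le> 4/3 * K + 7/3" using K[OF xT, of M] by (simp add: a_def)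
      finally have "(\<Sum>n<M. (1/r) ^ n * b n) \<le> 4/3 * K + 7/3" .
      then show "r powi (- i) * (\<Sum>n<M. (1/r) ^ n * b n) \<le> (2 * K + 3) * r powi (- i)"
        using K[OF xT, of 0] r by (auto simp: mult.commute intro!: mult_right_mono)
    qed
    finally show "sum ?f F \<le> ennreal ((2 * K + 3) * r powi (- i))" .
  qed (rule nonneg_summable_on_complete, simp)
  show ?thesis
    unfolding theta_def
  proof (rule INF_lower2)
    show "(C, \<mu>) \<in> {(C, \<mu>). increasing_partitions i T C \<and> prob_space \<mu> \<and> space \<mu> = T \<and>
                        (\<forall>j\<ge>i. C j \<subseteq> sets \<mu>)}"
      using inc prob space sets by (auto simp: C_def Z_def)
  qed (auto intro!: SUP_least main)
qed

lemma phi_add_le: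
  assumes r: "0 \<le> r"
    and "\<And>m. m \<in> {1..N} \<Longrightarrow> s m = u m + b m" "\<And>m. m \<in> {1..N} \<Longrightarrow> t m = v m + c m"
  shows "phi r N j s t \<le> 2 * (phi r N j u v + phi r N j b c)"
proof -
  have *: "min 1 (w * (x + y)\<^sup>2) \<le> 2 * (min 1 (w * x\<^sup>2) + min 1 (w * y\<^sup>2))" if "0 \<le> w" for w x y :: real
  proof -
    have "(x + y)\<^sup>2 \<le> 2 * (x\<^sup>2 + y\<^sup>2)"
      using sum_squares_bound[of x y] by (simp add: power2_sum)
    then have "w * (x + y)\<^sup>2 \<le> w * (2 * (x\<^sup>2 + y\<^sup>2))"
      using that by (rule mult_left_mono)
    also have "\<dots> = 2 * (w * x\<^sup>2) + 2 * (w * y\<^sup>2)" by (simp add: algebra_simps)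
    finally have "w * (x + y)\<^sup>2 \<le> 2 * (w * x\<^sup>2) + 2 * (w * y\<^sup>2)" .
    moreover have "0 \<le> w * x\<^sup>2" "0 \<le> w * y\<^sup>2" using that by simp_all
    ultimately show ?thesis by (smt (verit))
  qed
  have "phi r N j s t = (\<Sum>m\<in>{1..N}. min 1 (r powi (2 * j) * ((u m - v m) + (b m - c m))\<^sup>2))"
    unfolding phi_def using assms by (intro sum.cong) (auto simp: algebra_simps)
  also have "\<dots> \<le> (\<Sum>m\<in>{1..N}. 2 * (min 1 (r powi (2 * j) * (u m - v m)\<^sup>2) + min 1 (r powi (2 * j) * (b m - c m)\<^sup>2)))"
    using r by (intro sum_mono *) auto
  also have "\<dots> = 2 * (phi r N j u v + phi r N j b c)"
    by (simp add: phi_def sum.distrib sum_distrib_left)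
  finally show ?thesis .
qed

lemma phi_le_dist: "phi r N j s t \<le> r powi (2 * j) * (euclid_dist N s t)\<^sup>2"
proof -
  have "phi r N j s t \<le> (\<Sum>m\<in>{1..N}. r powi (2 * j) * (s m - t m)\<^sup>2)"
    unfolding phi_def by (intro sum_mono) auto
  also have "\<dots> = r powi (2 * j) * (euclid_dist N s t)\<^sup>2"
    by (simp add: euclid_dist_def L2_set_def sum_nonneg sum_distrib_left)
  finally show ?thesis .
qed

lemma phi_scaled_zero:
  assumes "r \<noteq> 0"
  shows "phi r N (i + int n) (\<lambda>m. r powi (- i) * b m) (\<lambda>_. 0) = (\<Sum>m\<in>{1..N}. min 1 ((r ^ n)\<^sup>2 * (b m)\<^sup>2))"
proof -
  have "r powi (2 * (i + int n)) * (r powi (- i))\<^sup>2 = (r ^ n)\<^sup>2"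
    using assms by (simp add: power_int_add power_int_mult power_int_minus power2_eq_square mult_2 field_simps)
  then show ?thesis
    by (simp add: phi_def power_mult_distrib mult.assoc[symmetric])
qed

lemma sum_min_power_le:
  fixes r a :: real
  assumes r: "r \<ge> 4" and a: "0 \<le> a"
  shows "(\<Sum>n<M. (1/r) ^ n * min 1 ((r ^ n)\<^sup>2 * a\<^sup>2)) \<le> 4 * a"
proof (cases "a = 0")
  case False
  with a have "0 < a" by simp
  have "(1/r) ^ n * min 1 ((r ^ n)\<^sup>2 * a\<^sup>2) \<le>
      a\<^sup>2 * (if r ^ n < 1.5 / a then r ^ n else 0) + (if (1/r) ^ n < a then (1/r) ^ n else 0)" for n
  proof -
    have "0 < r ^ n" using r by simp
    have "(1/r) ^ n * min 1 ((r ^ n)\<^sup>2 * a\<^sup>2) \<le> (1/r) ^ n * ((r ^ n)\<^sup>2 * a\<^sup>2)"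
      using r by (intro mult_left_mono) auto
    also have "\<dots> = a\<^sup>2 * r ^ n"
      using \<open>0 < r ^ n\<close> by (simp add: power_one_over field_simps power2_eq_square)
    finally have 1: "(1/r) ^ n * min 1 ((r ^ n)\<^sup>2 * a\<^sup>2) \<le> a\<^sup>2 * r ^ n" .
    have 2: "(1/r) ^ n * min 1 ((r ^ n)\<^sup>2 * a\<^sup>2) \<le> (1/r) ^ n"
      using r by (intro mult_left_le) auto
    show ?thesis
    proof (cases "r ^ n < 1.5 / a")
      case True
      have "0 \<le> (if (1/r) ^ n < a then (1/r) ^ n else 0)" using r by simp
      then show ?thesis using 1 unfolding if_P[OF True] by linarith
    next
      case False
      then have "(1/r) ^ n < a"
        using \<open>0 < r ^ n\<close> \<open>0 < a\<close> by (simp add: power_one_over field_simps)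
      then show ?thesis using False 2 by simp
    qed
  qed
  then have "(\<Sum>n<M. (1/r) ^ n * min 1 ((r ^ n)\<^sup>2 * a\<^sup>2)) \<le>
      a\<^sup>2 * (\<Sum>n<M. if r ^ n < 1.5 / a then r ^ n else 0) + (\<Sum>n<M. if (1/r) ^ n < a then (1/r) ^ n else 0)"
    unfolding sum_distrib_left sum.distrib[symmetric] by (intro sum_mono)
  also have "\<dots> \<le> a\<^sup>2 * (4/3 * (1.5 / a)) + 4/3 * a"
    using r a by (intro add_mono mult_left_mono sum_power_below_le sum_power_below_le') (auto simp: field_simps)
  also have "\<dots> \<le> 4 * a" using \<open>0 < a\<close> by (simp add: power2_eq_square)
  finally show ?thesis .
qed simp

lemma B1_labels:
  assumes r: "r \<ge> 4"
  obtains h :: "nat \<Rightarrow> (nat \<Rightarrow> real) \<Rightarrow> nat" and q :: "nat \<Rightarrow> nat pmf" and d :: "nat \<Rightarrow> (nat \<Rightarrow> real) \<Rightarrow> real"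
  where "\<And>n. finite (h n ` B1 N)"
    and "\<And>n x. x \<in> B1 N \<Longrightarrow> 0 < pmf (q n) (h n x)"
    and "\<And>n x s t. x \<in> B1 N \<Longrightarrow> s \<in> B1 N \<Longrightarrow> t \<in> B1 N \<Longrightarrow> h n s = h n x \<Longrightarrow> h n t = h n x \<Longrightarrow>
              phi r N (i + int n) (\<lambda>m. r powi (- i) * s m) (\<lambda>m. r powi (- i) * t m) \<le> d n x"
    and "\<And>x M. x \<in> B1 N \<Longrightarrow> (\<Sum>n<M. (1/r) ^ n * (d n x + ln (1 / pmf (q n) (h n x)))) \<le> 24 + r"
proof -
  define \<psi> where "\<psi> n b = (\<Sum>m\<in>{1..N}. min 1 ((r ^ n)\<^sup>2 * (b m)\<^sup>2))" for n and b :: "nat \<Rightarrow> real"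
  define h where "h n b = nat \<lfloor>\<psi> n b\<rfloor>" for n b
  define q where "q n = pmf_of_set {..nat \<lfloor>r ^ n\<rfloor>}" for n
  define d where "d n x = 4 * \<psi> n x + 4" for n x
  have "r \<noteq> 0" using r by simp
  have \<psi>0: "0 \<le> \<psi> n b" for n b unfolding \<psi>_def by (intro sum_nonneg) auto
  have \<psi>le: "\<psi> n b \<le> r ^ n" if "b \<in> B1 N" for n b
  proof -
    have "\<psi> n b \<le> (\<Sum>m\<in>{1..N}. r ^ n * \<bar>b m\<bar>)"
      unfolding \<psi>_def
    proof (rule sum_mono)
      fix m
      define y where "y = r ^ n * \<bar>b m\<bar>"
      have "0 \<le> y" using r by (simp add: y_def)
      have "min 1 (y\<^sup>2) \<le> y"
      proof (cases "y \<le> 1")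
        case True
        then show ?thesis using \<open>0 \<le> y\<close> by (simp add: min.coboundedI2 power2_eq_square mult_left_le)
      qed auto
      then show "min 1 ((r ^ n)\<^sup>2 * (b m)\<^sup>2) \<le> r ^ n * \<bar>b m\<bar>" by (simp add: y_def power_mult_distrib)
    qed
    also have "\<dots> = r ^ n * (\<Sum>m\<in>{1..N}. \<bar>b m\<bar>)" by (simp add: sum_distrib_left)
    also have "\<dots> \<le> r ^ n" using that r by (intro mult_left_le) (auto simp: B1_def)
    finally show ?thesis .
  qed
  have h_in: "h n b \<in> {..nat \<lfloor>r ^ n\<rfloor>}" if "b \<in> B1 N" for n b
    unfolding h_def using \<psi>le[OF that, of n] by (auto intro!: nat_mono floor_mono)
  have pmf_q: "pmf (q n) (h n b) = 1 / (1 + real (nat \<lfloor>r ^ n\<rfloor>))" if "b \<in> B1 N" for n b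
    unfolding q_def using h_in[OF that, of n] by (simp add: pmf_of_set)
  have log: "ln (1 / pmf (q n) (h n b)) \<le> 1 + real n * r" if "b \<in> B1 N" for n b
  proof -
    have "1 \<le> r ^ n" using r by simp
    have "0 < 1 / pmf (q n) (h n b)" using pmf_q[OF that, of n] by (simp add: add_pos_nonneg)
    have "1 / pmf (q n) (h n b) = 1 + real (nat \<lfloor>r ^ n\<rfloor>)" using that by (simp add: pmf_q)
    also have "\<dots> \<le> 1 + r ^ n" using r by simp
    also have "\<dots> \<le> 2 * r ^ n" using \<open>1 \<le> r ^ n\<close> by simp
    finally have "ln (1 / pmf (q n) (h n b)) \<le> ln (2 * r ^ n)"
      using r \<open>0 < 1 / pmf (q n) (h n b)\<close> by (subst ln_le_cancel_iff) auto
    also have "\<dots> = ln 2 + real n * ln r"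
      using r by (simp add: ln_mult_pos ln_realpow)
    also have "\<dots> \<le> 1 + real n * r"
      using r ln_2_less_1 ln_le_minus_one[of r] by (intro add_mono mult_left_mono) auto
    finally show ?thesis .
  qed
  show ?thesis
  proof (rule that[of h q d])
    show "finite (h n ` B1 N)" for n
      using h_in by (auto intro: finite_subset[of _ "{..nat \<lfloor>r ^ n\<rfloor>}"])
    show "0 < pmf (q n) (h n x)" if "x \<in> B1 N" for n x
      using pmf_q[OF that] by (simp add: add_pos_nonneg)
    show "phi r N (i + int n) (\<lambda>m. r powi (- i) * s m) (\<lambda>m. r powi (- i) * t m) \<le> d n x"
      if "h n s = h n x" "h n t = h n x" for n x s t
    proof -
      have close: "\<psi> n y \<le> \<psi> n x + 1" if "h n y = h n x" for y
      proof -
        have "\<lfloor>\<psi> n y\<rfloor> = \<lfloor>\<psi> n x\<rfloor>" using that \<psi>0 unfolding h_def by (metis eq_nat_nat_iff zero_le_floor)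
        then show ?thesis by linarith
      qed
      have "phi r N (i + int n) (\<lambda>m. r powi (- i) * s m) (\<lambda>m. r powi (- i) * t m) \<le>
         2 * (phi r N (i + int n) (\<lambda>m. r powi (- i) * s m) (\<lambda>_. 0) + phi r N (i + int n) (\<lambda>_. 0) (\<lambda>m. r powi (- i) * t m))"
        using r by (intro phi_add_le) auto
      also have "\<dots> = 2 * (phi r N (i + int n) (\<lambda>m. r powi (- i) * s m) (\<lambda>_. 0) + phi r N (i + int n) (\<lambda>m. r powi (- i) * t m) (\<lambda>_. 0))"
        by (simp add: phi_def)
      also have "\<dots> = 2 * (\<psi> n s + \<psi> n t)"
        by (simp only: phi_scaled_zero[OF \<open>r \<noteq> 0\<close>] \<psi>_def)
      also have "\<dots> \<le> d n x"
        using close[OF that(1)] close[OF that(2)] by (simp add: d_def)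
      finally show ?thesis .
    qed
    show "(\<Sum>n<M. (1/r) ^ n * (d n x + ln (1 / pmf (q n) (h n x)))) \<le> 24 + r" if "x \<in> B1 N" for x M
    proof -
      have "(\<Sum>n<M. (1/r) ^ n * (d n x + ln (1 / pmf (q n) (h n x)))) \<le>
          (\<Sum>n<M. (1/r) ^ n * (d n x + (1 + real n * r)))"
        using log[OF that] r by (intro sum_mono mult_left_mono add_left_mono) auto
      also have "\<dots> = 4 * (\<Sum>n<M. (1/r) ^ n * \<psi> n x) + 5 * (\<Sum>n<M. (1/r) ^ n) + r * (\<Sum>n<M. real n * (1/r) ^ n)"
        by (simp add: d_def algebra_simps sum.distrib sum_distrib_left)
      also have "(\<Sum>n<M. (1/r) ^ n * \<psi> n x) = (\<Sum>m\<in>{1..N}. \<Sum>n<M. (1/r) ^ n * min 1 ((r ^ n)\<^sup>2 * \<bar>x m\<bar>\<^sup>2))"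
        unfolding \<psi>_def sum_distrib_left by (subst sum.swap) simp
      also have "\<dots> \<le> (\<Sum>m\<in>{1..N}. 4 * \<bar>x m\<bar>)"
        using r by (intro sum_mono sum_min_power_le) auto
      also have "\<dots> = 4 * (\<Sum>m\<in>{1..N}. \<bar>x m\<bar>)" by (simp add: sum_distrib_left)
      also have "\<dots> \<le> 4" using that by (simp add: B1_def)
      also have "(\<Sum>n<M. (1/r) ^ n) \<le> 4/3" using r by (intro sum_power_le) auto
      also have "r * (\<Sum>n<M. real n * (1/r) ^ n) \<le> r * 1"
        using r by (intro mult_left_mono sum_of_nat_mult_power_le) auto
      finally show ?thesis by simp
    qed
  qed
qed

lemma ex_pmf_ge:
  fixes w :: "'a \<Rightarrow> real"
  assumes A: "finite A" and w: "\<And>a. a \<in> A \<Longrightarrow> 0 \<le> w a" and le: "sum w A \<le> 1"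
  shows "\<exists>q. \<forall>a\<in>A. w a \<le> pmf q a"
proof (cases "sum w A = 0")
  case True
  then have "\<forall>a\<in>A. w a = 0" using A w by (simp add: sum_nonneg_eq_0_iff)
  then show ?thesis by auto
next
  case False
  then have s: "0 < sum w A" using w by (simp add: sum_nonneg order_less_le)
  define f where "f a = (if a \<in> A then w a / sum w A else 0)" for a
  have f0: "0 \<le> f a" for a using w s by (simp add: f_def)
  have "(\<integral>\<^sup>+a. ennreal (f a) \<partial>count_space UNIV) = (\<Sum>a\<in>A. ennreal (f a))"
    by (rule nn_integral_count_space'[OF A]) (auto simp: f_def)
  also have "\<dots> = ennreal (\<Sum>a\<in>A. f a)" using f0 by (intro sum_ennreal)
  also have "(\<Sum>a\<in>A. f a) = 1" using s by (simp add: f_def sum_divide_distrib[symmetric])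
  finally have "pmf (embed_pmf f) a = f a" for a using f0 by (intro pmf_embed_pmf) auto
  moreover have "w a \<le> f a" if "a \<in> A" for a
    using that le s w[OF that] by (simp add: f_def field_simps mult_left_le)
  ultimately show ?thesis by metis
qed

lemma (in prob_space) ex_maximal_disjoint:
  assumes B: "\<And>x. x \<in> S \<Longrightarrow> B x \<in> events" and c: "0 < c" "\<And>x. x \<in> S \<Longrightarrow> c \<le> prob (B x)"
  shows "\<exists>A. finite A \<and> A \<subseteq> S \<and> (\<forall>x\<in>S. \<exists>a\<in>A. B a \<inter> B x \<noteq> {}) \<and> (\<Sum>a\<in>A. prob (B a)) \<le> 1"
proof -
  define P where "P A \<longleftrightarrow> finite A \<and> A \<subseteq> S \<and> disjoint_family_on B A" for A
  have sum: "(\<Sum>a\<in>A. prob (B a)) \<le> 1" if "P A" for A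
  proof -
    have "(\<Sum>a\<in>A. prob (B a)) = prob (\<Union>a\<in>A. B a)"
      using that B by (intro finite_measure_finite_Union[symmetric]) (auto simp: P_def)
    then show ?thesis by simp
  qed
  have card: "card A \<le> nat \<lfloor>1 / c\<rfloor>" if "P A" for A
  proof -
    have "real (card A) * c \<le> (\<Sum>a\<in>A. prob (B a))"
      using that c by (intro sum_bounded_below) (auto simp: P_def)
    also have "\<dots> \<le> 1" by (rule sum[OF that])
    finally show ?thesis using c by (simp add: le_nat_floor field_simps)
  qed
  have "\<exists>A. P A \<and> (\<forall>A'. P A' \<longrightarrow> card A' \<le> card A)"
  proof (rule ex_has_greatest_nat)
    show "P {}" by (simp add: P_def disjoint_family_on_def)
    show "\<forall>A. P A \<longrightarrow> card A < Suc (nat \<lfloor>1 / c\<rfloor>)" using card by (simp add: less_Suc_eq_le)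
  qed
  then obtain A where A: "P A" and max: "\<And>A'. P A' \<Longrightarrow> card A' \<le> card A"
    by (elim exE conjE) simp
  have "\<exists>a\<in>A. B a \<inter> B x \<noteq> {}" if x: "x \<in> S" for x
  proof (rule ccontr)
    assume *: "\<not> ?thesis"
    have "B x \<noteq> {}" using c(1) c(2)[OF x] by auto
    then have "x \<notin> A" using * by auto
    have "P (insert x A)"
      using A * x unfolding P_def disjoint_family_on_def by (auto simp: Int_commute)
    then show False using max[of "insert x A"] A \<open>x \<notin> A\<close> by (auto simp: P_def)
  qed
  then show ?thesis using A sum[OF A] unfolding P_def by blast
qed

lemma sum_le_nn_integral_antimono:
  fixes g :: "real \<Rightarrow> ennreal" and e :: "nat \<Rightarrow> real"
  assumes g: "\<And>a b. 0 \<le> a \<Longrightarrow> a \<le> b \<Longrightarrow> g b \<le> g a"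
    and e: "decseq e" "\<And>k. 0 \<le> e k"
  shows "(\<Sum>k<M. g (e k) * ennreal (e k - e (Suc k))) \<le> (\<integral>\<^sup>+t\<in>{0..}. g t \<partial>lborel)"
proof -
  have le: "e (Suc k) \<le> e k" for k using e(1) by (simp add: decseq_Suc_iff)
  have pw: "(\<Sum>k<M. g (e k) * indicator {e (Suc k)<..e k} t) \<le> g t * indicator {e M<..} t" for t
  proof (induction M)
    case (Suc M)
    show ?case
    proof (cases "e M < t")
      case True
      then show ?thesis using Suc le[of M] by (simp split: split_indicator)
    next
      case False
      then show ?thesis using Suc g[of t "e M"] e(2)[of "Suc M"] by (auto split: split_indicator)
    qed
  qed simp
  have "(\<Sum>k<M. g (e k) * ennreal (e k - e (Suc k))) =
      (\<integral>\<^sup>+t. (\<Sum>k<M. g (e k) * indicator {e (Suc k)<..e k} t) \<partial>lborel)"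
    using le by (subst nn_integral_sum) (auto simp: nn_integral_cmult_indicator)
  also have "\<dots> \<le> (\<integral>\<^sup>+t\<in>{0..}. g t \<partial>lborel)"
  proof (rule nn_integral_mono)
    fix t
    have "g t * indicator {e M<..} t \<le> g t * indicator {0..} t"
      using e(2)[of M] by (auto split: split_indicator)
    then show "(\<Sum>k<M. g (e k) * indicator {e (Suc k)<..e k} t) \<le> g t * indicator {0..} t"
      using pw[of t] by (rule order_trans[rotated])
  qed
  finally show ?thesis .
qed

lemma euclid_dist_commute: "euclid_dist N s t = euclid_dist N t s"
  by (simp add: euclid_dist_def L2_set_def power2_commute)

lemma euclid_dist_triangle: "euclid_dist N s u \<le> euclid_dist N s t + euclid_dist N t u"
  using L2_set_triangle_ineq[of "\<lambda>m. s m - t m" "\<lambda>m. t m - u m" "{1..N}"]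
  by (simp add: euclid_dist_def)

lemma euclid_dist_nonneg: "0 \<le> euclid_dist N s t"
  by (simp add: euclid_dist_def)

lemma esqrt_log_inv_antimono:
  assumes "0 \<le> p" "p \<le> p'" "p' \<le> 1"
  shows "esqrt (log_inv p') \<le> esqrt (log_inv p)"
proof (cases "p = 0")
  case False
  then have "0 \<le> ln (1 / p')" "ln (1 / p') \<le> ln (1 / p)"
    using assms by (auto intro!: ln_ge_zero divide_left_mono)
  then show ?thesis using assms False
    by (simp add: esqrt_def log_inv_def ennreal_leI)
qed (simp add: esqrt_def log_inv_def)

lemma sum_shift_le:
  fixes f :: "nat \<Rightarrow> real"
  assumes "\<And>l. 0 \<le> f l"
  shows "(\<Sum>n<M. if k < n then f (n - Suc k) else 0) \<le> (\<Sum>l<M. f l)"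
proof -
  have "(\<Sum>n<M. if k < n then f (n - Suc k) else 0) = (\<Sum>n\<in>{n\<in>{..<M}. k < n}. f (n - Suc k))"
    by (subst sum.inter_filter) auto
  also have "\<dots> = sum f ((\<lambda>n. n - Suc k) ` {n\<in>{..<M}. k < n})"
    by (subst sum.reindex) (auto simp: inj_on_def)
  also have "\<dots> \<le> (\<Sum>l<M. f l)"
    using assms by (intro sum_mono2) auto
  finally show ?thesis .
qed

lemma gamma_half_witness:
  assumes gam: "gamma_half N U \<le> ennreal \<rho>" and \<rho>: "0 < \<rho>" and U: "U \<subseteq> RN N"
  obtains \<mu> where "prob_space \<mu>" "\<And>x e. {y\<in>U. euclid_dist N x y \<le> e} \<in> sets \<mu>" "space \<mu> = U"
    "\<And>x. x \<in> U \<Longrightarrow>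
      (\<integral>\<^sup>+\<epsilon>\<in>{0..}. esqrt (log_inv (measure \<mu> {y\<in>U. euclid_dist N x y \<le> \<epsilon>})) \<partial>lborel) \<le> ennreal (2 * \<rho>)"
proof -
  have "gamma_half N U < ennreal (2 * \<rho>)"
    by (rule order_le_less_trans[OF gam]) (use \<rho> in \<open>simp add: ennreal_less_iff\<close>)
  then obtain \<mu> where \<mu>: "prob_space \<mu>" "sets \<mu> = sets (restrict_space (borel_RN N) U)"
    and le: "(SUP x\<in>U. \<integral>\<^sup>+\<epsilon>\<in>{0..}. esqrt (log_inv (measure \<mu> {y\<in>U. euclid_dist N x y \<le> \<epsilon>})) \<partial>lborel) < ennreal (2 * \<rho>)"
    unfolding gamma_half_def by (subst (asm) INF_less_iff) auto
  have spaceRN: "space (borel_RN N) = RN N"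
    by (simp add: borel_RN_def RN_def space_PiM)
  show ?thesis
  proof (rule that[OF \<mu>(1)])
    show "space \<mu> = U"
      using U by (subst sets_eq_imp_space_eq[OF \<mu>(2)]) (auto simp: space_restrict_space spaceRN)
    show "{y\<in>U. euclid_dist N x y \<le> e} \<in> sets \<mu>" for x e
    proof -
      have "(\<lambda>y. euclid_dist N x y) \<in> borel_measurable (borel_RN N)"
        unfolding euclid_dist_def L2_set_def borel_RN_def by measurable
      then have "{y \<in> space (borel_RN N). euclid_dist N x y \<le> e} \<in> sets (borel_RN N)"
        by measurable
      moreover have "{y\<in>U. euclid_dist N x y \<le> e} = U \<inter> {y \<in> space (borel_RN N). euclid_dist N x y \<le> e}"
        using U spaceRN by auto
      ultimately show ?thesis unfolding \<mu>(2) sets_restrict_space by auto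
    qed
    show "(\<integral>\<^sup>+\<epsilon>\<in>{0..}. esqrt (log_inv (measure \<mu> {y\<in>U. euclid_dist N x y \<le> \<epsilon>})) \<partial>lborel) \<le> ennreal (2 * \<rho>)"
      if "x \<in> U" for x
      using SUP_lessD[OF le that] by (rule less_imp_le)
  qed
qed

lemma gamma_half_labels:
  assumes r: "r \<ge> 4" and U: "U \<subseteq> RN N" and gam: "gamma_half N U \<le> ennreal (r powi (- i))"
  obtains h :: "nat \<Rightarrow> (nat \<Rightarrow> real) \<Rightarrow> nat \<times> (nat \<Rightarrow> real)" and q and d :: "nat \<Rightarrow> (nat \<Rightarrow> real) \<Rightarrow> real"
  where "U \<noteq> {}" and "\<And>n. finite (h n ` U)"
    and "\<And>n x. x \<in> U \<Longrightarrow> 0 < pmf (q n) (h n x)"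
    and "\<And>n x s t. x \<in> U \<Longrightarrow> s \<in> U \<Longrightarrow> t \<in> U \<Longrightarrow> h n s = h n x \<Longrightarrow> h n t = h n x \<Longrightarrow>
              phi r N (i + int n) s t \<le> d n x"
    and "\<And>x M. x \<in> U \<Longrightarrow> (\<Sum>n<M. (1/r) ^ n * (d n x + ln (1 / pmf (q n) (h n x)))) \<le> 1025 * (2 + r\<^sup>2) + 1"
proof -
  define \<rho> where "\<rho> = r powi (- i)"
  have \<rho>: "0 < \<rho>" using r by (simp add: \<rho>_def)
  obtain \<mu> where \<mu>: "prob_space \<mu>" "\<And>x e. {y\<in>U. euclid_dist N x y \<le> e} \<in> sets \<mu>" "space \<mu> = U"
    and I: "\<And>x. x \<in> U \<Longrightarrow>
      (\<integral>\<^sup>+\<epsilon>\<in>{0..}. esqrt (log_inv (measure \<mu> {y\<in>U. euclid_dist N x y \<le> \<epsilon>})) \<partial>lborel) \<le> ennreal (2 * \<rho>)"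
    proof (rule gamma_half_witness[OF gam[folded \<rho>_def] \<rho> U], goal_cases)
      case (1 \<mu>)
      show ?case by (rule 1(1)[OF 1(2-)])
    qed
  interpret prob_space \<mu> by fact
  define Ba where "Ba x \<epsilon> = {y\<in>U. euclid_dist N x y \<le> \<epsilon>}" for x \<epsilon>
  have Ba: "Ba x e \<in> events" for x e using \<mu>(2) by (simp add: Ba_def)
  define g where "g x \<epsilon> = esqrt (log_inv (prob (Ba x \<epsilon>)))" for x \<epsilon>
  define G where "G x \<epsilon> = sqrt (ln (1 / prob (Ba x \<epsilon>)))" for x \<epsilon>
  have mono: "prob (Ba x a) \<le> prob (Ba x b)" if "a \<le> b" for x a b
    using that Ba by (intro finite_measure_mono) (auto simp: Ba_def)
  have dyadic: "(\<Sum>k<M. g x (e k) * ennreal (e k - e (Suc k))) \<le> ennreal (2 * \<rho>)"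
    if "x \<in> U" "decseq e" "\<And>k. 0 \<le> e k" for x e M
  proof (rule order_trans)
    show "(\<Sum>k<M. g x (e k) * ennreal (e k - e (Suc k))) \<le> (\<integral>\<^sup>+t\<in>{0..}. g x t \<partial>lborel)"
      using that(2,3) mono unfolding g_def
      by (intro sum_le_nn_integral_antimono esqrt_log_inv_antimono measure_nonneg prob_le_1)
    show "(\<integral>\<^sup>+t\<in>{0..}. g x t \<partial>lborel) \<le> ennreal (2 * \<rho>)"
      using I[OF that(1)] unfolding g_def Ba_def .
  qed
  have one: "g x \<epsilon> * ennreal \<epsilon> \<le> ennreal (2 * \<rho>)" if "x \<in> U" "0 \<le> \<epsilon>" for x \<epsilon>
    using dyadic[of x "\<lambda>k. if k = 0 then \<epsilon> else 0" 1] that by (simp add: decseq_def)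
  have pos: "0 < prob (Ba x \<epsilon>)" if "x \<in> U" "0 < \<epsilon>" for x \<epsilon>
  proof (rule ccontr)
    assume "\<not> 0 < prob (Ba x \<epsilon>)"
    then have "g x \<epsilon> = \<infinity>" by (simp add: g_def esqrt_def log_inv_def zero_less_measure_iff)
    then show False using one[of x \<epsilon>] that by (simp add: ennreal_top_mult top_unique)
  qed
  have gG: "g x \<epsilon> = ennreal (G x \<epsilon>)" if "x \<in> U" "0 < \<epsilon>" for x \<epsilon>
    using pos[OF that] by (simp add: g_def G_def esqrt_def log_inv_def)
  have G0: "0 \<le> G x \<epsilon>" if "x \<in> U" "0 < \<epsilon>" for x \<epsilon>
    using pos[OF that] by (simp add: G_def)
  have half: "1/2 < prob (Ba x (4 * \<rho>))" if "x \<in> U" for x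
  proof -
    let ?p = "prob (Ba x (4 * \<rho>))"
    have p: "0 < ?p" using that \<rho> by (intro pos) auto
    have "ennreal (G x (4 * \<rho>) * (4 * \<rho>)) \<le> ennreal (2 * \<rho>)"
      using one[of x "4 * \<rho>"] that \<rho> G0[of x "4 * \<rho>"] by (simp add: gG ennreal_mult)
    then have "G x (4 * \<rho>) * (4 * \<rho>) \<le> 2 * \<rho>" using \<rho> by (subst (asm) ennreal_le_iff) auto
    then have "G x (4 * \<rho>) \<le> 1/2" using \<rho> by (simp add: field_simps)
    then have "ln (1 / ?p) \<le> (1/2)\<^sup>2" unfolding G_def by (rule sqrt_le_D)
    then have "ln ?p \<ge> - 1/4" using p by (simp add: ln_div power2_eq_square)
    then have "exp (- 1/4) \<le> ?p" using p by (simp add: ln_ge_iff)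
    moreover have "1 + (- 1/4) \<le> exp (- 1/4 :: real)" by (rule exp_ge_add_one_self)
    ultimately show ?thesis by linarith
  qed
  have diam: "euclid_dist N x y \<le> 8 * \<rho>" if "x \<in> U" "y \<in> U" for x y
  proof (rule ccontr)
    assume far: "\<not> ?thesis"
    have "Ba x (4 * \<rho>) \<inter> Ba y (4 * \<rho>) = {}"
    proof (rule ccontr)
      assume "\<not> ?thesis"
      then obtain z where "euclid_dist N x z \<le> 4 * \<rho>" "euclid_dist N y z \<le> 4 * \<rho>" by (auto simp: Ba_def)
      then show False using far euclid_dist_triangle[of N x y z] euclid_dist_commute[of N z y] by linarith
    qed
    then have "prob (Ba x (4 * \<rho>)) + prob (Ba y (4 * \<rho>)) = prob (Ba x (4 * \<rho>) \<union> Ba y (4 * \<rho>))"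
      using Ba by (intro finite_measure_Union[symmetric]) auto
    then show False using half[OF that(1)] half[OF that(2)] prob_le_1[of "Ba x (4 * \<rho>) \<union> Ba y (4 * \<rho>)"] by linarith
  qed
  \<comment> \<open>The factor 8 makes the ball of radius \<open>e 0\<close> equal to \<open>U\<close>, so that scale 0 is always admissible.\<close>
  define e where "e k = 8 * \<rho> * (1/r) ^ k" for k
  have e0: "0 < e k" for k using \<rho> r by (simp add: e_def)
  have edec: "decseq e" using \<rho> r by (auto simp: decseq_def e_def intro!: mult_left_mono power_decreasing)
  have full: "prob (Ba x (e 0)) = 1" if "x \<in> U" for x
  proof -
    have "Ba x (e 0) = space \<mu>" using diam that by (auto simp: Ba_def e_def \<mu>(3))
    then show ?thesis by (simp add: prob_space)
  qed
  define good where "good n x k \<longleftrightarrow> k \<le> n \<and> exp (- (r ^ (n - k))\<^sup>2) \<le> prob (Ba x (e k))" for n x k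
  define kk where "kk n x = Max {k. good n x k}" for n x
  have fin_good: "finite {k. good n x k}" for n x
    by (rule finite_subset[of _ "{..n}"]) (auto simp: good_def)
  have good0: "good n x 0" if "x \<in> U" for n x using full[OF that] by (simp add: good_def)
  have kk: "good n x (kk n x)" if "x \<in> U" for n x
    using Max_in[OF fin_good[of n x]] good0[OF that, of n] unfolding kk_def by blast
  have kk_max: "k \<le> kk n x" if "good n x k" for n x k
    unfolding kk_def using fin_good that by (intro Max_ge) auto
  define S where "S n k = {x\<in>U. kk n x = k}" for n k
  have "\<exists>A. finite A \<and> A \<subseteq> S n k \<and> (\<forall>x\<in>S n k. \<exists>a\<in>A. Ba a (e k) \<inter> Ba x (e k) \<noteq> {}) \<and>
      (\<Sum>a\<in>A. prob (Ba a (e k))) \<le> 1" for n k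
    using kk by (intro ex_maximal_disjoint[where c = "exp (- (r ^ (n - k))\<^sup>2)"] Ba) (auto simp: S_def good_def)
  then obtain A where A: "\<And>n k. finite (A n k)" "\<And>n k. A n k \<subseteq> S n k"
    "\<And>n k x. x \<in> S n k \<Longrightarrow> \<exists>a\<in>A n k. Ba a (e k) \<inter> Ba x (e k) \<noteq> {}"
    "\<And>n k. (\<Sum>a\<in>A n k. prob (Ba a (e k))) \<le> 1"
    by metis
  define center where "center n x = (SOME a. a \<in> A n (kk n x) \<and> Ba a (e (kk n x)) \<inter> Ba x (e (kk n x)) \<noteq> {})" for n x
  have center: "center n x \<in> A n (kk n x)" "Ba (center n x) (e (kk n x)) \<inter> Ba x (e (kk n x)) \<noteq> {}"
    if "x \<in> U" for n x
    using someI_ex[of "\<lambda>a. a \<in> A n (kk n x) \<and> Ba a (e (kk n x)) \<inter> Ba x (e (kk n x)) \<noteq> {}"]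
      A(3)[of x n "kk n x"] that unfolding center_def S_def by auto
  have center_dist: "euclid_dist N (center n x) x \<le> 2 * e (kk n x)" if x: "x \<in> U" for n x
  proof -
    obtain z where "euclid_dist N (center n x) z \<le> e (kk n x)" "euclid_dist N x z \<le> e (kk n x)"
      using center(2)[OF x, of n] by (auto simp: Ba_def)
    then show ?thesis
      using euclid_dist_triangle[of N "center n x" x z] euclid_dist_commute[of N z x] by linarith
  qed
  define h where "h n x = (kk n x, center n x)" for n x
  have h_in: "h n x \<in> Sigma {..n} (A n)" if "x \<in> U" for n x
    using center(1)[OF that, of n] kk[OF that, of n] by (simp add: h_def good_def)
  define w where "w n = (\<lambda>(k, a). prob (Ba a (e k)) / (real n + 1))" for n :: nat
  have "\<exists>q. \<forall>b\<in>Sigma {..n} (A n). w n b \<le> pmf q b" for n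
  proof (rule ex_pmf_ge)
    have "sum (w n) (Sigma {..n} (A n)) = (\<Sum>k\<le>n. (\<Sum>a\<in>A n k. prob (Ba a (e k))) / (real n + 1))"
      using A(1) by (simp add: sum.Sigma w_def sum_divide_distrib)
    also have "\<dots> \<le> (\<Sum>k\<le>n. 1 / (real n + 1))"
      using A(4) by (intro sum_mono divide_right_mono) auto
    also have "\<dots> = 1" by (simp add: field_simps)
    finally show "sum (w n) (Sigma {..n} (A n)) \<le> 1" .
  qed (use A(1) in \<open>auto simp: w_def\<close>)
  then obtain q where q: "\<And>n b. b \<in> Sigma {..n} (A n) \<Longrightarrow> w n b \<le> pmf (q n) b" by metis
  define c where "c n x = (r ^ (n - kk n x))\<^sup>2" for n x
  have pmf_q: "exp (- c n x) / (real n + 1) \<le> pmf (q n) (h n x)" if "x \<in> U" for n x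
  proof -
    have "center n x \<in> S n (kk n x)" using center(1)[OF that] A(2) by blast
    then have "center n x \<in> U" "kk n (center n x) = kk n x" by (auto simp: S_def)
    then have "exp (- c n x) \<le> prob (Ba (center n x) (e (kk n x)))"
      using kk[of "center n x" n] by (simp add: good_def c_def)
    then have "exp (- c n x) / (real n + 1) \<le> w n (h n x)"
      by (simp add: w_def h_def divide_right_mono)
    then show ?thesis using q[OF h_in[OF that, of n]] by linarith
  qed
  have q_pos: "0 < pmf (q n) (h n x)" if "x \<in> U" for n x
    using pmf_q[OF that, of n] by (rule order_less_le_trans[rotated]) (simp add: add_nonneg_pos)
  have log: "ln (1 / pmf (q n) (h n x)) \<le> c n x + real n" if "x \<in> U" for n x
  proof -
    have "- c n x - ln (real n + 1) = ln (exp (- c n x) / (real n + 1))" by (simp add: ln_div)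
    also have "\<dots> \<le> ln (pmf (q n) (h n x))"
      using pmf_q[OF that, of n] q_pos[OF that, of n] by (subst ln_le_cancel_iff) (auto simp: add_nonneg_pos)
    finally have "ln (1 / pmf (q n) (h n x)) \<le> c n x + ln (real n + 1)"
      using q_pos[OF that, of n] by (simp add: ln_div)
    then show ?thesis using ln_add_one_self_le_self[of "real n"] by (simp add: add.commute)
  qed
  have dist_le: "phi r N (i + int n) s t \<le> 1024 * c n x"
    if "x \<in> U" "s \<in> U" "t \<in> U" "h n s = h n x" "h n t = h n x" for n x s t
  proof -
    let ?k = "kk n x"
    have eq: "kk n s = ?k" "kk n t = ?k" "center n s = center n t" using that by (auto simp: h_def)
    have "?k \<le> n" using kk[OF that(1), of n] by (simp add: good_def)
    have "euclid_dist N s t \<le> 4 * e ?k"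
      using center_dist[OF that(2), of n] center_dist[OF that(3), of n] eq
        euclid_dist_triangle[of N s t "center n s"] euclid_dist_commute[of N s "center n s"] by simp
    then have "(euclid_dist N s t)\<^sup>2 \<le> (4 * e ?k)\<^sup>2"
      using euclid_dist_nonneg by (rule power_mono)
    then have "phi r N (i + int n) s t \<le> r powi (2 * (i + int n)) * (4 * e ?k)\<^sup>2"
      using phi_le_dist[of r N "i + int n" s t] r
      by (elim order_trans) (auto intro!: mult_left_mono)
    also have "r powi (2 * (i + int n)) = (r powi (i + int n))\<^sup>2"
      unfolding mult.commute[of 2 "i + int n"] power_int_mult by simp
    also have "(r powi (i + int n))\<^sup>2 * (4 * e ?k)\<^sup>2 = 1024 * (r powi (i + int n) * \<rho> * (1/r) ^ ?k)\<^sup>2"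
      by (simp add: e_def power_mult_distrib)
    also have "r powi (i + int n) * \<rho> * (1/r) ^ ?k = r ^ (n - ?k)"
      using r \<open>?k \<le> n\<close> by (simp add: \<rho>_def power_int_add power_int_minus power_diff power_one_over field_simps)
    finally show ?thesis by (simp add: c_def)
  qed
  have Sbound: "(\<Sum>n<M. (1/r) ^ n * c n x) \<le> 2 + r\<^sup>2" if x: "x \<in> U" for x M
  proof -
    define F where "F k l = (if r ^ l < G x (e (Suc k)) then r ^ l else 0)" for k l :: nat
    have F0: "0 \<le> F k l" for k l using r by (simp add: F_def)
    have *: "(1/r) ^ n * c n x \<le> (1/r) ^ n + (\<Sum>k<M. r * (1/r) ^ k * (if k < n then F k (n - Suc k) else 0))"
      if "n < M" for n
    proof (cases "kk n x = n")
      case True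
      then have "c n x = 1" by (simp add: c_def)
      moreover have "0 \<le> (\<Sum>k<M. r * (1/r) ^ k * (if k < n then F k (n - Suc k) else 0))"
        using r F0 by (intro sum_nonneg) auto
      ultimately show ?thesis by simp
    next
      case False
      define k where "k = kk n x"
      have "k < n" using False kk[OF x, of n] by (simp add: good_def k_def)
      then have "\<not> good n x (Suc k)" using kk_max[of n x "Suc k"] by (auto simp: k_def)
      then have lt: "prob (Ba x (e (Suc k))) < exp (- (r ^ (n - Suc k))\<^sup>2)"
        using \<open>k < n\<close> by (simp add: good_def)
      have p: "0 < prob (Ba x (e (Suc k)))" using e0 x by (intro pos)
      have "(r ^ (n - Suc k))\<^sup>2 < ln (1 / prob (Ba x (e (Suc k))))"
      proof -
        have "ln (prob (Ba x (e (Suc k)))) < ln (exp (- (r ^ (n - Suc k))\<^sup>2))"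
          using lt p by (subst ln_less_cancel_iff) auto
        then show ?thesis using p by (simp add: ln_div)
      qed
      then have "r ^ (n - Suc k) < G x (e (Suc k))"
        unfolding G_def by (rule real_less_rsqrt)
      then have "F k (n - Suc k) = r ^ (n - Suc k)" by (simp add: F_def)
      have n: "n = k + Suc (n - Suc k)" using \<open>k < n\<close> by simp
      define l where "l = n - Suc k"
      have nl: "n = k + Suc l" using n by (simp add: l_def)
      have "(1/r) ^ n * c n x = r * (1/r) ^ k * F k l"
        unfolding c_def k_def[symmetric] using \<open>F k (n - Suc k) = r ^ (n - Suc k)\<close> r
        by (simp add: nl power_add power2_eq_square power_one_over field_simps)
      also have "\<dots> = r * (1/r) ^ k * (if k < n then F k (n - Suc k) else 0)"
        using \<open>k < n\<close> by (simp add: l_def)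
      also have "\<dots> \<le> (\<Sum>k<M. r * (1/r) ^ k * (if k < n then F k (n - Suc k) else 0))"
        using r F0 \<open>k < n\<close> \<open>n < M\<close> by (intro member_le_sum) auto
      also have "\<dots> \<le> (1/r) ^ n + \<dots>" using r by simp
      finally show ?thesis .
    qed
    have "(\<Sum>n<M. (1/r) ^ n * c n x) \<le>
        (\<Sum>n<M. (1/r) ^ n + (\<Sum>k<M. r * (1/r) ^ k * (if k < n then F k (n - Suc k) else 0)))"
      using * by (intro sum_mono) auto
    also have "\<dots> = (\<Sum>n<M. (1/r) ^ n) + (\<Sum>k<M. r * (1/r) ^ k * (\<Sum>n<M. if k < n then F k (n - Suc k) else 0))"
      unfolding sum.distrib sum_distrib_left by (subst (2) sum.swap) simp
    also have "\<dots> \<le> 4/3 + (\<Sum>k<M. r * (1/r) ^ k * (4/3 * G x (e (Suc k))))"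
    proof (intro add_mono sum_mono mult_left_mono)
      fix k
      have "(\<Sum>n<M. if k < n then F k (n - Suc k) else 0) \<le> (\<Sum>l<M. F k l)"
        by (intro sum_shift_le F0)
      also have "\<dots> \<le> 4/3 * G x (e (Suc k))"
        unfolding F_def using r x e0 by (intro sum_power_below_le G0)
      finally show "(\<Sum>n<M. if k < n then F k (n - Suc k) else 0) \<le> 4/3 * G x (e (Suc k))" .
      show "(\<Sum>n<M. (1/r) ^ n) \<le> 4/3" using r by (intro sum_power_le) auto
    qed (use r in auto)
    also have "(\<Sum>k<M. r * (1/r) ^ k * (4/3 * G x (e (Suc k)))) = 4/3 * r\<^sup>2 * (\<Sum>k<M. (1/r) ^ Suc k * G x (e (Suc k)))"
      unfolding sum_distrib_left using r by (intro sum.cong) (auto simp: power2_eq_square field_simps)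
    also have "4/3 + 4/3 * r\<^sup>2 * (\<Sum>k<M. (1/r) ^ Suc k * G x (e (Suc k))) \<le> 2 + r\<^sup>2"
    proof -
      have diff: "6 * \<rho> * (1/r) ^ Suc k \<le> e (Suc k) - e (Suc (Suc k))" for k
      proof -
        have "e (Suc (Suc k)) = 8 * \<rho> * (1/r) ^ Suc k * (1/r)" by (simp add: e_def)
        also have "\<dots> \<le> 8 * \<rho> * (1/r) ^ Suc k * (1/4)"
          using r \<rho> by (intro mult_left_mono) (auto simp: field_simps)
        finally show ?thesis by (simp add: e_def)
      qed
      have dec: "e (Suc (Suc k)) \<le> e (Suc k)" for k using edec by (simp add: decseq_Suc_iff)
      have "ennreal (\<Sum>k<M. G x (e (Suc k)) * (e (Suc k) - e (Suc (Suc k)))) =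
          (\<Sum>k<M. g x (e (Suc k)) * ennreal (e (Suc k) - e (Suc (Suc k))))"
        using dec G0[OF x e0] by (subst sum_ennreal[symmetric]) (auto simp: gG[OF x e0] ennreal_mult)
      also have "\<dots> \<le> ennreal (2 * \<rho>)"
        using edec e0 by (intro dyadic x) (auto simp: decseq_Suc_iff less_imp_le)
      finally have "(\<Sum>k<M. G x (e (Suc k)) * (e (Suc k) - e (Suc (Suc k)))) \<le> 2 * \<rho>"
        using \<rho> by (subst (asm) ennreal_le_iff) auto
      moreover have "(\<Sum>k<M. G x (e (Suc k)) * (6 * \<rho> * (1/r) ^ Suc k)) \<le>
          (\<Sum>k<M. G x (e (Suc k)) * (e (Suc k) - e (Suc (Suc k))))"
        using diff G0[OF x e0] by (intro sum_mono mult_left_mono)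
      moreover have "(\<Sum>k<M. G x (e (Suc k)) * (6 * \<rho> * (1/r) ^ Suc k)) =
          6 * \<rho> * (\<Sum>k<M. (1/r) ^ Suc k * G x (e (Suc k)))"
        unfolding sum_distrib_left by (intro sum.cong) auto
      ultimately have "6 * \<rho> * (\<Sum>k<M. (1/r) ^ Suc k * G x (e (Suc k))) \<le> 2 * \<rho>" by linarith
      then have "(\<Sum>k<M. (1/r) ^ Suc k * G x (e (Suc k))) \<le> 1/3"
        using \<rho> by (simp add: field_simps)
      then have "4/3 * r\<^sup>2 * (\<Sum>k<M. (1/r) ^ Suc k * G x (e (Suc k))) \<le> 4/3 * r\<^sup>2 * (1/3)"
        by (intro mult_left_mono) auto
      then show ?thesis using zero_le_power2[of r] by linarith
    qed
    finally show ?thesis .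
  qed
  show ?thesis
  proof (rule that[of h q "\<lambda>n x. 1024 * c n x"])
    show "U \<noteq> {}" using \<mu>(3) not_empty by simp
    show "finite (h n ` U)" for n
    proof (rule finite_subset)
      show "h n ` U \<subseteq> Sigma {..n} (A n)" using h_in by (intro image_subsetI)
      show "finite (Sigma {..n} (A n))" using A(1) by auto
    qed
    show "(\<Sum>n<M. (1/r) ^ n * (1024 * c n x + ln (1 / pmf (q n) (h n x)))) \<le> 1025 * (2 + r\<^sup>2) + 1"
      if x: "x \<in> U" for x M
    proof -
      have "(\<Sum>n<M. (1/r) ^ n * (1024 * c n x + ln (1 / pmf (q n) (h n x)))) \<le>
          (\<Sum>n<M. (1/r) ^ n * (1024 * c n x + (c n x + real n)))"
        using r log[OF x] by (intro sum_mono mult_left_mono add_left_mono) auto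
      also have "\<dots> = (\<Sum>n<M. 1025 * ((1/r) ^ n * c n x) + real n * (1/r) ^ n)"
        by (intro sum.cong) (auto simp: algebra_simps)
      also have "\<dots> = 1025 * (\<Sum>n<M. (1/r) ^ n * c n x) + (\<Sum>n<M. real n * (1/r) ^ n)"
        unfolding sum.distrib sum_distrib_left ..
      also have "\<dots> \<le> 1025 * (2 + r\<^sup>2) + 1"
        using r by (intro add_mono mult_left_mono Sbound[OF x] sum_of_nat_mult_power_le) auto
      finally show ?thesis .
    qed
    show "0 < pmf (q n) (h n x)" if "x \<in> U" for n x
      by (rule q_pos[OF that])
    show "phi r N (i + int n) s t \<le> 1024 * c n x"
      if "x \<in> U" "s \<in> U" "t \<in> U" "h n s = h n x" "h n t = h n x" for n x s t
      by (rule dist_le[OF that])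
  qed
qed

theorem proposition4p4:
  fixes r :: real
  assumes "r \<ge> 4"
  shows "\<exists>K::real. \<forall>(N::nat) (i::int) U. U \<subseteq> RN N \<longrightarrow>
           gamma_half N U \<le> ennreal (r powi (- i)) \<longrightarrow>
           theta r N i (plus_scaled N U (r powi (- i)) (B1 N)) \<le> ennreal (K * r powi (- i))"
proof (intro exI allI impI)
  fix N i U
  assume U: "U \<subseteq> RN N" and gam: "gamma_half N U \<le> ennreal (r powi (- i))"
  define KU where "KU = 1025 * (2 + r\<^sup>2) + 1"
  define T where "T = plus_scaled N U (r powi (- i)) (B1 N)"
  obtain hU :: "nat \<Rightarrow> (nat \<Rightarrow> real) \<Rightarrow> nat \<times> (nat \<Rightarrow> real)" and qU dU where
    Une: "U \<noteq> {}" and finU: "\<And>n. finite (hU n ` U)" and posU: "\<And>n x. x \<in> U \<Longrightarrow> 0 < pmf (qU n) (hU n x)"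
    and dU: "\<And>n x s t. x \<in> U \<Longrightarrow> s \<in> U \<Longrightarrow> t \<in> U \<Longrightarrow> hU n s = hU n x \<Longrightarrow> hU n t = hU n x \<Longrightarrow>
              phi r N (i + int n) s t \<le> dU n x"
    and KU: "\<And>x M. x \<in> U \<Longrightarrow> (\<Sum>n<M. (1/r) ^ n * (dU n x + ln (1 / pmf (qU n) (hU n x)))) \<le> KU"
    proof (rule gamma_half_labels[OF assms U gam, folded KU_def], goal_cases)
      case (1 h q d)
      show ?case by (rule 1(1)[OF 1(2-)])
    qed
  obtain hB :: "nat \<Rightarrow> (nat \<Rightarrow> real) \<Rightarrow> nat" and qB dB where
    finB: "\<And>n. finite (hB n ` B1 N)" and posB: "\<And>n x. x \<in> B1 N \<Longrightarrow> 0 < pmf (qB n) (hB n x)"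
    and dB: "\<And>n x s t. x \<in> B1 N \<Longrightarrow> s \<in> B1 N \<Longrightarrow> t \<in> B1 N \<Longrightarrow> hB n s = hB n x \<Longrightarrow> hB n t = hB n x \<Longrightarrow>
              phi r N (i + int n) (\<lambda>m. r powi (- i) * s m) (\<lambda>m. r powi (- i) * t m) \<le> dB n x"
    and KB: "\<And>x M. x \<in> B1 N \<Longrightarrow> (\<Sum>n<M. (1/r) ^ n * (dB n x + ln (1 / pmf (qB n) (hB n x)))) \<le> 24 + r"
    proof (rule B1_labels[OF assms, of N i], goal_cases)
      case (1 h q d)
      show ?case by (rule 1(1)[OF 1(2-)])
    qed
  have "\<exists>u b. u \<in> U \<and> b \<in> B1 N \<and> t = (\<lambda>m\<in>{1..N}. u m + r powi (- i) * b m)" if "t \<in> T" for t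
    using that unfolding T_def plus_scaled_def by blast
  then obtain u b where ub: "\<And>t. t \<in> T \<Longrightarrow> u t \<in> U" "\<And>t. t \<in> T \<Longrightarrow> b t \<in> B1 N"
    "\<And>t. t \<in> T \<Longrightarrow> t = (\<lambda>m\<in>{1..N}. u t m + r powi (- i) * b t m)"
    by metis
  have "restrict (\<lambda>_. 0) {1..N} \<in> B1 N" by (simp add: B1_def RN_def)
  then have "T \<noteq> {}" using Une unfolding T_def plus_scaled_def by blast
  have "theta r N i T \<le> ennreal ((2 * (2 * KU + 2 * (24 + r)) + 3) * r powi (- i))"
  proof (rule theta_le_of_labels[where h = "\<lambda>n t. (hU n (u t), hB n (b t))" and q = "\<lambda>n. pair_pmf (qU n) (qB n)"
        and d = "\<lambda>n t. 2 * (dU n (u t) + dB n (b t))", OF assms \<open>T \<noteq> {}\<close>])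
    show "finite ((\<lambda>t. (hU n (u t), hB n (b t))) ` T)" for n
      by (rule finite_subset[OF _ finite_cartesian_product[OF finU[of n] finB[of n]]]) (use ub in auto)
    show "0 < pmf (pair_pmf (qU n) (qB n)) (hU n (u x), hB n (b x))" if "x \<in> T" for n x
      using posU posB ub that by (simp add: pmf_pair)
    show "phi r N (i + int n) s t \<le> 2 * (dU n (u x) + dB n (b x))"
      if "x \<in> T" "s \<in> T" "t \<in> T" "(hU n (u s), hB n (b s)) = (hU n (u x), hB n (b x))"
        "(hU n (u t), hB n (b t)) = (hU n (u x), hB n (b x))" for n x s t
    proof -
      have eq: "v m = u v m + r powi (- i) * b v m" if "v \<in> T" "m \<in> {1..N}" for v m
        using fun_cong[OF ub(3)[OF that(1)], of m] that(2) by simp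
      have "phi r N (i + int n) s t \<le> 2 * (phi r N (i + int n) (u s) (u t) +
          phi r N (i + int n) (\<lambda>m. r powi (- i) * b s m) (\<lambda>m. r powi (- i) * b t m))"
        using eq that assms by (intro phi_add_le) auto
      also have "\<dots> \<le> 2 * (dU n (u x) + dB n (b x))"
        using ub that by (intro mult_left_mono add_mono dU dB) auto
      finally show ?thesis .
    qed
    show "(\<Sum>n<M. (1/r) ^ n * (2 * (dU n (u x) + dB n (b x)) +
        ln (1 / pmf (pair_pmf (qU n) (qB n)) (hU n (u x), hB n (b x))))) \<le> 2 * KU + 2 * (24 + r)"
      if x: "x \<in> T" for x M
    proof -
      define lU where "lU n = ln (1 / pmf (qU n) (hU n (u x)))" for n
      define lB where "lB n = ln (1 / pmf (qB n) (hB n (b x)))" for n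
      have l: "0 \<le> lU n" "0 \<le> lB n"
        "ln (1 / pmf (pair_pmf (qU n) (qB n)) (hU n (u x), hB n (b x))) = lU n + lB n" for n
        using posU[OF ub(1)[OF x], of n] posB[OF ub(2)[OF x], of n]
          pmf_le_1[of "qU n" "hU n (u x)"] pmf_le_1[of "qB n" "hB n (b x)"]
        by (simp_all add: lU_def lB_def pmf_pair ln_div ln_mult_pos)
      have "(\<Sum>n<M. (1/r) ^ n * (2 * (dU n (u x) + dB n (b x)) + (lU n + lB n))) \<le>
          (\<Sum>n<M. (1/r) ^ n * (2 * (dU n (u x) + dB n (b x)) + (2 * lU n + 2 * lB n)))"
        using assms l by (intro sum_mono mult_left_mono add_mono) auto
      also have "\<dots> = 2 * (\<Sum>n<M. (1/r) ^ n * (dU n (u x) + lU n)) + 2 * (\<Sum>n<M. (1/r) ^ n * (dB n (b x) + lB n))"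
        by (simp add: algebra_simps sum.distrib sum_distrib_left)
      also have "\<dots> \<le> 2 * KU + 2 * (24 + r)"
        unfolding lU_def lB_def using ub x by (intro add_mono mult_left_mono KU KB) auto
      finally show ?thesis unfolding l(3) .
    qed
  qed
  then show "theta r N i (plus_scaled N U (r powi (- i)) (B1 N)) \<le>
      ennreal ((2 * (2 * (1025 * (2 + r\<^sup>2) + 1) + 2 * (24 + r)) + 3) * r powi (- i))"
    by (simp only: T_def KU_def)
qed

end
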